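(* Let $\mathfrak{B}$ be an arbitrary Banach space, let $a\in\mathbb{R}$ and let $f\in L_1^{loc}([a,\infty),\mathfrak{B})$. Suppose that there exist a point $t_0\in(a,\infty)$ and a number $\alpha\in(0,1]$ such that the conformable derivative $T_a^{\alpha}f(t_0)$ with lower terminal $a$ exists. Then for every $\beta\in(0,1]$ with $\beta\neq\alpha$ the conformable derivative $T_a^{\beta}f(t_0)$ exists and $$T_a^{\alpha}f(t_0)=(t_0-a)^{\beta-\alpha}\,T_a^{\beta}f(t_0).$$
   Context: $L_1^{loc}([a,\infty),\mathfrak{B})$ denotes the linear space of all functions $f:[a,\infty)\to\mathfrak{B}$ that are Bochner strongly measurable and Bochner integrable (i.e. $\|f(t)\|_{\mathfrak{B}}$ is Lebesgue integrable) on every compact subinterval of $[a,\infty)$. For $\alpha\in(0,1]$ and $t\in(a,\infty)$, the (left-sided) conformable derivative of order $\alpha$ of $f$ at $t$ with lower terminal $a$ is $$T_a^{\alpha}f(t)=\lim_{\theta\to 0}\frac{f(t+\theta(t-a)^{1-\alpha})-f(t)}{\theta},$$ if this limit exists in the norm of $\mathfrak{B}$. *)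

theory Defs
  imports "HOL-Analysis.Analysis"
begin

text \<open>
  The library constants \<^const>\<open>integrable\<close> and \<^const>\<open>set_integrable\<close> require the range type to be
  second countable, i.e. they only cover separable Banach spaces.  Bochner integrability in an
  arbitrary Banach space is therefore defined here in the classical way: strong measurability
  (almost everywhere limit of simple functions) together with Lebesgue integrability of the norm.
\<close>

definition strongly_measurable :: "'a measure \<Rightarrow> ('a \<Rightarrow> 'b::real_normed_vector) \<Rightarrow> bool" where
  "strongly_measurable M f \<longleftrightarrow>
     (\<exists>s :: nat \<Rightarrow> 'a \<Rightarrow> 'b. (\<forall>n. simple_function M (s n)) \<and>
        (AE x in M. (\<lambda>n. s n x) \<longlonglongrightarrow> f x))"

definition bochner_integrable :: "'a measure \<Rightarrow> ('a \<Rightarrow> 'b::real_normed_vector) \<Rightarrow> bool" where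
  "bochner_integrable M f \<longleftrightarrow> strongly_measurable M f \<and> integrable M (\<lambda>x. norm (f x))"

text \<open>
  A function on \<open>[a, \<infinity>)\<close> is represented by a total function on the reals.  Its values to the left
  of \<open>a\<close> are irrelevant, both below and in the derivative at a point \<open>t > a\<close>, where
  \<open>t + \<theta> (t - a)\<^sup>1\<^sup>-\<^sup>\<alpha> > a\<close> for all \<open>\<theta>\<close> close to \<open>0\<close>.
\<close>

definition L1_loc :: "real \<Rightarrow> (real \<Rightarrow> 'b::real_normed_vector) set" where
  "L1_loc a = {f. \<forall>c d. a \<le> c \<and> c \<le> d \<longrightarrow> bochner_integrable (lebesgue_on {c..d}) f}"

text \<open>The following notions are meaningful for \<open>0 < \<alpha> \<le> 1\<close> and \<open>a < t\<close> only.\<close>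

definition conformable_quotient ::
    "real \<Rightarrow> real \<Rightarrow> (real \<Rightarrow> 'b::real_normed_vector) \<Rightarrow> real \<Rightarrow> real \<Rightarrow> 'b" where
  "conformable_quotient a \<alpha> f t \<theta> = (f (t + \<theta> * (t - a) powr (1 - \<alpha>)) - f t) /\<^sub>R \<theta>"

definition conformable_differentiable ::
    "real \<Rightarrow> real \<Rightarrow> (real \<Rightarrow> 'b::real_normed_vector) \<Rightarrow> real \<Rightarrow> bool" where
  "conformable_differentiable a \<alpha> f t \<longleftrightarrow> (\<exists>D. (conformable_quotient a \<alpha> f t \<longlongrightarrow> D) (at 0))"

definition conformable_derivative ::
    "real \<Rightarrow> real \<Rightarrow> (real \<Rightarrow> 'b::real_normed_vector) \<Rightarrow> real \<Rightarrow> 'b" where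
  "conformable_derivative a \<alpha> f t = Lim (at 0) (conformable_quotient a \<alpha> f t)"

end

theory Submission
  imports Defs
begin

text \<open>
  Substituting \<open>\<theta> \<mapsto> (t - a) powr (\<alpha> - \<beta>) * \<theta>\<close> turns the difference quotient of order \<open>\<alpha>\<close> into
  that of order \<open>\<beta>\<close>, up to the same factor.
\<close>

lemma conformable_quotient_rescale:
  fixes f :: "real \<Rightarrow> 'b::real_normed_vector" and a t \<alpha> \<beta> :: real
  assumes "a < t"
  defines "c \<equiv> (t - a) powr (\<alpha> - \<beta>)"
  shows "conformable_quotient a \<beta> f t \<theta> = c *\<^sub>R conformable_quotient a \<alpha> f t (c * \<theta>)"
proof -
  have "c > 0"
    using assms by simp
  \<comment> \<open>The exponents add up: (\<alpha> - \<beta>) + (1 - \<alpha>) = 1 - \<beta>. Hence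
    order \<beta> at \<open>\<theta>\<close> and order \<alpha> at \<open>c * \<theta>\<close>
    evaluate \<open>f\<close> at the same point.\<close>
  moreover have "(t - a) powr (1 - \<beta>) = c * (t - a) powr (1 - \<alpha>)"
    unfolding c_def by (simp flip: powr_add)
  \<comment> \<open>The numerators agree, and the outer \<open>c\<close> cancels the one in the
    denominator \<open>c * \<theta>\<close>. At \<open>\<theta> = 0\<close> both sides are 0, since
    \<open>inverse 0 = 0\<close>.\<close>
  ultimately show ?thesis
    by (simp add: conformable_quotient_def mult.assoc mult.left_commute)
qed

text \<open>Scaling by a positive constant respects punctured neighbourhoods of 0, so the pointwise
  identity passes to the limit. This yields both existence and value of the derivative of order
  \<beta>.\<close>

lemma tendsto_conformable_quotient_rescale:
  fixes f :: "real \<Rightarrow> 'b::real_normed_vector"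
  assumes "a < t" and D: "(conformable_quotient a \<alpha> f t \<longlongrightarrow> D) (at 0)"
  shows "(conformable_quotient a \<beta> f t \<longlongrightarrow> (t - a) powr (\<alpha> - \<beta>) *\<^sub>R D) (at 0)"
proof -
  define c where "c = (t - a) powr (\<alpha> - \<beta>)"
  have "c > 0"
    using assms by (simp add: c_def)
  \<comment> \<open>The target \<open>at 0\<close> excludes 0 itself, so besides
    \<open>c * \<theta>\<close> tending to 0 this needs \<open>c * \<theta> \<noteq> 0\<close> for
    \<open>\<theta> \<noteq> 0\<close>.\<close>
  then have "filterlim (\<lambda>\<theta>. c * \<theta>) (at 0) (at 0)"
    by (auto simp: filterlim_at eventually_at_filter intro!: tendsto_eq_intros)
  then have "((\<lambda>\<theta>. c *\<^sub>R conformable_quotient a \<alpha> f t (c * \<theta>)) \<longlongrightarrow> c *\<^sub>R D) (at 0)"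
    by (intro tendsto_intros filterlim_compose[OF D])
  then show ?thesis
    unfolding c_def conformable_quotient_rescale[OF \<open>a < t\<close>, of \<beta> f _ \<alpha>, symmetric] .
qed

lemma conformable_derivative_eqI:
  "(conformable_quotient a \<alpha> f t \<longlongrightarrow> D) (at 0) \<Longrightarrow> conformable_derivative a \<alpha> f t = D"
  unfolding conformable_derivative_def by (rule tendsto_Lim) simp_all

theorem theorem3p3:
  fixes f :: "real \<Rightarrow> 'b::banach" and a t\<^sub>0 \<alpha> :: real
  assumes "f \<in> L1_loc a"
    and "t\<^sub>0 \<in> {a<..}"
    and "\<alpha> \<in> {0<..1}"
    and "conformable_differentiable a \<alpha> f t\<^sub>0"
  shows "\<forall>\<beta>\<in>{0<..1}. \<beta> \<noteq> \<alpha> \<longrightarrow>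
           conformable_differentiable a \<beta> f t\<^sub>0 \<and>
           conformable_derivative a \<alpha> f t\<^sub>0 =
             (t\<^sub>0 - a) powr (\<beta> - \<alpha>) *\<^sub>R conformable_derivative a \<beta> f t\<^sub>0"
proof (intro ballI impI)
  fix \<beta> :: real
  have "a < t\<^sub>0"
    using assms(2) by simp
  obtain D where D: "(conformable_quotient a \<alpha> f t\<^sub>0 \<longlongrightarrow> D) (at 0)"
    using assms(4) by (auto simp: conformable_differentiable_def)
  note E = tendsto_conformable_quotient_rescale[OF \<open>a < t\<^sub>0\<close> D, of \<beta>]
  \<comment> \<open>\<open>E\<close> expresses the derivative of order \<beta> through
    \<open>D\<close>; the goal runs the other way, so the factor has to be inverted.\<close>
  have "(t\<^sub>0 - a) powr (\<beta> - \<alpha>) * (t\<^sub>0 - a) powr (\<alpha> - \<beta>) = 1"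
    using \<open>a < t\<^sub>0\<close> by (simp flip: powr_add)
  then show "conformable_differentiable a \<beta> f t\<^sub>0 \<and>
      conformable_derivative a \<alpha> f t\<^sub>0 =
        (t\<^sub>0 - a) powr (\<beta> - \<alpha>) *\<^sub>R conformable_derivative a \<beta> f t\<^sub>0"
    using E conformable_derivative_eqI[OF D] conformable_derivative_eqI[OF E]
    by (auto simp: conformable_differentiable_def)
qed

end
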